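(* Let $U$ be an associative commutative algebra with derivation $\partial$ over a field of characteristic $p=3$. Endow $U$ with the $3$-ary multiplication $V^{1,2,3}$. Then $U$ is a Lie triple system.
   Context: $V^{1,2,3}(u_1,u_2,u_3)=\det\big(\partial^{i}u_j\big)_{1\le i,j\le 3}$. A Lie triple system is a vector space $A$ with a trilinear product $[a,b,c]$ such that $[a,a,c]=0$; $[a,b,c]+[b,c,a]+[c,a,b]=0$; and $[a,b,[c,d,e]]=[[a,b,c],d,e]+[c,[a,b,d],e]+[c,d,[a,b,e]]$ for all $a,b,c,d,e\in A$. *)

theory Defs
  imports "HOL-Analysis.Determinants"
begin

text \<open>
  The class \<open>comm_ring\<close> does not provide a unit, so algebras are not assumed to be unital.
  Compatibility of the scalars with the second factor follows from commutativity.
\<close>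

locale comm_assoc_algebra = vector_space scale
  for scale :: "'k::field \<Rightarrow> 'a::comm_ring \<Rightarrow> 'a" +
  assumes scale_mult_left: "scale c x * y = scale c (x * y)"

locale comm_assoc_algebra_with_derivation = comm_assoc_algebra scale
  for scale :: "'k::field \<Rightarrow> 'a::comm_ring \<Rightarrow> 'a" +
  fixes D :: "'a \<Rightarrow> 'a"
  assumes derivation_linear: "Vector_Spaces.linear scale scale D"
    and derivation_mult: "D (x * y) = D x * y + x * D y"

text \<open>
  The library determinant is only available over unital commutative rings (it uses the
  unit in its signs and products), hence the Leibniz formula for \<open>3 \<times> 3\<close> matrices is written
  out here. The two agree whenever there is a unit.
\<close>

definition det3 :: "'a::comm_ring^3^3 \<Rightarrow> 'a" where
  "det3 A =
     A$1$1 * A$2$2 * A$3$3 +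
     A$1$2 * A$2$3 * A$3$1 +
     A$1$3 * A$2$1 * A$3$2 -
     A$1$1 * A$2$3 * A$3$2 -
     A$1$2 * A$2$1 * A$3$3 -
     A$1$3 * A$2$2 * A$3$1"

lemma det3_eq_det: "det3 A = det A" for A :: "'a::comm_ring_1^3^3"
  by (simp add: det3_def det_3)

definition V123 :: "('a \<Rightarrow> 'a) \<Rightarrow> 'a \<Rightarrow> 'a \<Rightarrow> 'a \<Rightarrow> 'a::comm_ring" where
  "V123 D u1 u2 u3 = det3 (vector
     [vector [(D ^^ 1) u1, (D ^^ 1) u2, (D ^^ 1) u3],
      vector [(D ^^ 2) u1, (D ^^ 2) u2, (D ^^ 2) u3],
      vector [(D ^^ 3) u1, (D ^^ 3) u2, (D ^^ 3) u3]])"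

locale lie_triple_system = vector_space scale
  for scale :: "'k::field \<Rightarrow> 'a::ab_group_add \<Rightarrow> 'a" +
  fixes br :: "'a \<Rightarrow> 'a \<Rightarrow> 'a \<Rightarrow> 'a"
  assumes linear_1: "Vector_Spaces.linear scale scale (\<lambda>a. br a b c)"
    and linear_2: "Vector_Spaces.linear scale scale (\<lambda>b. br a b c)"
    and linear_3: "Vector_Spaces.linear scale scale (\<lambda>c. br a b c)"
    and br_same: "br a a c = 0"
    and br_cyclic: "br a b c + br b c a + br c a b = 0"
    and br_br: "br a b (br c d e) = br (br a b c) d e + br c (br a b d) e + br c d (br a b e)"

end

theory Submission
  imports Defs
begin

text \<open>
  In characteristic 3 the cube of a derivation is a derivation. For fixed \<open>a, b\<close> the map
  \<open>L = [a, b, \<cdot>]\<close> has the form \<open>\<alpha> \<partial> + \<beta> \<partial>\<^sup>2 + \<gamma> \<partial>\<^sup>3\<close> with \<open>\<partial> \<gamma> = - \<beta>\<close>, and every such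
  operator is a derivation of the bracket. Indeed, write \<open>|i, j, k|\<close> for the determinant with rows
  \<open>\<partial>\<^sup>i, \<partial>\<^sup>j, \<partial>\<^sup>k\<close> in \<open>c, d, e\<close>. Letting \<open>L\<close> act on the columns of \<open>|1, 2, 3|\<close> amounts to replacing
  the rows, one at a time, by those of \<open>\<partial> L, \<partial>\<^sup>2 L, \<partial>\<^sup>3 L\<close>; the multiples of \<open>|1, 2, 3|\<close>
  so obtained add up to \<open>3 (\<partial> \<alpha>) |1, 2, 3| = 0\<close>, and what remains is \<open>L |1, 2, 3|\<close>.
\<close>

text \<open>The same formula as \<open>det3\<close>, with rows as triples so that rewriting can
  match whole rows.\<close>

definition rows_det :: "'a \<times> 'a \<times> 'a \<Rightarrow> 'a \<times> 'a \<times> 'a \<Rightarrow> 'a \<times> 'a \<times> 'a \<Rightarrow> 'a::comm_ring" where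
  "rows_det = (\<lambda>(x1, x2, x3) (y1, y2, y3) (z1, z2, z3).
     x1 * y2 * z3 + x2 * y3 * z1 + x3 * y1 * z2 - x1 * y3 * z2 - x2 * y1 * z3 - x3 * y2 * z1)"

lemma V123_eq_rows_det:
  "V123 D a b c = rows_det (D a, D b, D c) (D (D a), D (D b), D (D c))
     (D (D (D a)), D (D (D b)), D (D (D c)))"
  by (simp add: V123_def det3_def rows_det_def vector_3 numeral_2_eq_2 numeral_3_eq_3)

text \<open>Each Leibniz product has one factor from every row and one from every column, so
  replacing one factor at a time gives the same sum by rows as by columns.\<close>

lemma rows_det_replace_columns:
  "rows_det (p1, x2, x3) (q1, y2, y3) (r1, z2, z3)
   + rows_det (x1, p2, x3) (y1, q2, y3) (z1, r2, z3)
   + rows_det (x1, x2, p3) (y1, y2, q3) (z1, z2, r3)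
   = rows_det (p1, p2, p3) (y1, y2, y3) (z1, z2, z3)
   + rows_det (x1, x2, x3) (q1, q2, q3) (z1, z2, z3)
   + rows_det (x1, x2, x3) (y1, y2, y3) (r1, r2, r3)"
  by (simp add: rows_det_def algebra_simps)

lemma rows_det_comb_2:
  "rows_det (x1, x2, x3) (s * x1 + t * z1 + u, s * x2 + t * z2 + v, s * x3 + t * z3 + w) (z1, z2, z3)
   = rows_det (x1, x2, x3) (u, v, w) (z1, z2, z3)"
  by (simp add: rows_det_def algebra_simps)

lemma rows_det_comb_3:
  "rows_det (x1, x2, x3) (y1, y2, y3) (s * x1 + t * y1 + u, s * x2 + t * y2 + v, s * x3 + t * y3 + w)
   = rows_det (x1, x2, x3) (y1, y2, y3) (u, v, w)"
  by (simp add: rows_det_def algebra_simps)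

lemma rows_det_lin_2:
  "rows_det x (s * y1 + t * u1 + r * v1, s * y2 + t * u2 + r * v2, s * y3 + t * u3 + r * v3) z
   = s * rows_det x (y1, y2, y3) z + t * rows_det x (u1, u2, u3) z + r * rows_det x (v1, v2, v3) z"
  by (cases x; cases z) (simp add: rows_det_def algebra_simps)

lemma rows_det_lin_3:
  "rows_det x y (r * z1 + s * u1 + t * v1 + q * w1, r * z2 + s * u2 + t * v2 + q * w2,
     r * z3 + s * u3 + t * v3 + q * w3)
   = r * rows_det x y (z1, z2, z3) + s * rows_det x y (u1, u2, u3) + t * rows_det x y (v1, v2, v3)
     + q * rows_det x y (w1, w2, w3)"
  by (cases x; cases y) (simp add: rows_det_def algebra_simps)

lemma rows_det_swap_23: "rows_det x z y = - rows_det x y z"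
  by (cases x; cases y; cases z) (simp add: rows_det_def algebra_simps)

lemma rows_det_repeated [simp]: "rows_det x x y = 0" "rows_det x y y = 0"
  by (cases x; cases y; simp add: rows_det_def algebra_simps)+

context comm_assoc_algebra_with_derivation
begin

lemma derivation_simps:
  "D (x + y) = D x + D y" "D (x - y) = D x - D y" "D (- x) = - D x" "D (scale r x) = scale r (D x)"
proof -
  interpret D: Vector_Spaces.linear scale scale D
    by (rule derivation_linear)
  show "D (x + y) = D x + D y" "D (x - y) = D x - D y" "D (- x) = - D x"
    "D (scale r x) = scale r (D x)"
    by (simp_all add: D.add D.diff D.neg D.scale)
qed

lemma scale_mult_right: "x * scale r y = scale r (x * y)"
  using scale_mult_left[of r y x] by (simp add: mult.commute)

lemma V123_linear:
  "Vector_Spaces.linear scale scale (\<lambda>a. V123 D a b c)"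
  "Vector_Spaces.linear scale scale (\<lambda>b. V123 D a b c)"
  "Vector_Spaces.linear scale scale (\<lambda>c. V123 D a b c)"
  by (unfold_locales; simp add: V123_eq_rows_det rows_det_def derivation_simps scale_mult_left
      scale_mult_right algebra_simps)+

lemma derivation_rows_det:
  "D (rows_det (x1, x2, x3) (y1, y2, y3) (z1, z2, z3))
   = rows_det (D x1, D x2, D x3) (y1, y2, y3) (z1, z2, z3)
   + rows_det (x1, x2, x3) (D y1, D y2, D y3) (z1, z2, z3)
   + rows_det (x1, x2, x3) (y1, y2, y3) (D z1, D z2, D z3)"
  by (simp add: rows_det_def derivation_simps derivation_mult algebra_simps)

context
  assumes char_3: "CHAR('k) = 3"
begin

lemma triple_eq_0: "x + x + x = 0" for x :: 'a
proof -
  have "(3::'k) = 0"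
    using of_nat_CHAR[where 'a = 'k] char_3 by simp
  then have "scale 3 x = 0"
    by simp
  moreover have "scale 3 x = scale (1 + 1 + 1) x"
    by simp
  ultimately show ?thesis
    by (simp only: scale_left_distrib scale_one)
qed

text \<open>Both mixed terms of the Leibniz rule carry the binomial coefficient 3.\<close>

lemma derivation_cubed_mult: "D (D (D (x * y))) = D (D (D x)) * y + x * D (D (D y))"
proof -
  have "D (D (D (x * y))) = D (D (D x)) * y + x * D (D (D y))
      + (D (D x) * D y + D (D x) * D y + D (D x) * D y) + (D x * D (D y) + D x * D (D y) + D x * D (D y))"
    by (simp add: derivation_mult derivation_simps algebra_simps)
  then show ?thesis
    by (simp only: triple_eq_0 add_0_right)
qed

lemma third_order_operator_derivation_of_V123:
  assumes L: "\<And>x. L x = \<alpha> * D x + \<beta> * D (D x) + \<gamma> * D (D (D x))"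
    and \<gamma>: "D \<gamma> = - \<beta>"
  shows "L (V123 D c d e) = V123 D (L c) d e + V123 D c (L d) e + V123 D c d (L e)"
proof -
  define R where "R n = ((D ^^ n) c, (D ^^ n) d, (D ^^ n) e)" for n
  define W where "W i j k = rows_det (R i) (R j) (R k)" for i j k
  have R: "R 1 = (D c, D d, D e)"
    "R 2 = (D (D c), D (D d), D (D e))"
    "R 3 = (D (D (D c)), D (D (D d)), D (D (D e)))"
    "R 4 = (D (D (D (D c))), D (D (D (D d))), D (D (D (D e))))"
    "R 5 = (D (D (D (D (D c)))), D (D (D (D (D d)))), D (D (D (D (D e)))))"
    "R 6 = (D (D (D (D (D (D c))))), D (D (D (D (D (D d))))), D (D (D (D (D (D e))))))"
    by (simp_all add: R_def eval_nat_numeral)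
  have DW: "D (W i j k) = W (Suc i) j k + W i (Suc j) k + W i j (Suc k)" for i j k
    by (simp add: W_def R_def derivation_rows_det)
  have W_same [simp]: "W i i k = 0" "W i k k = 0" for i k
    by (simp_all add: W_def)
  have V: "V123 D c d e = W 1 2 3"
    by (simp only: V123_eq_rows_det W_def R)
  have D1: "D (W 1 2 3) = W 1 2 4"
    by (simp add: DW eval_nat_numeral)
  have D2: "D (D (W 1 2 3)) = W 1 3 4 + W 1 2 5"
    unfolding D1 by (simp add: DW eval_nat_numeral)
  \<comment> \<open>The cube of \<open>D\<close> is itself a derivation, so it raises one row index
    at a time by 3.\<close>
  have D3: "D (D (D (W 1 2 3))) = W 4 2 3 + W 1 5 3 + W 1 2 6"
    unfolding W_def R rows_det_def
    by (simp add: derivation_cubed_mult derivation_simps algebra_simps)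

  \<comment> \<open>The term in \<open>D (D (D x))\<close> has coefficient
    \<open>\<beta> + D \<gamma>\<close>, which vanishes.\<close>
  have DL: "D (L x) = D \<alpha> * D x + (\<alpha> + D \<beta>) * D (D x) + \<gamma> * D (D (D (D x)))" for x
    by (simp add: L derivation_mult derivation_simps \<gamma> algebra_simps)
  \<comment> \<open>Multiples of the other two rows, \<open>R 1\<close> and \<open>R 3\<close>, come
    first, in the shape that \<open>rows_det_comb_2\<close> discards; \<open>DDDL\<close> is
    arranged likewise for \<open>rows_det_comb_3\<close>.\<close>
  have DDL: "D (D (L x)) = D (D \<alpha>) * D x + (\<alpha> + D \<beta>) * D (D (D x))
      + ((D \<alpha> + D \<alpha> + D (D \<beta>)) * D (D x) + (- \<beta>) * D (D (D (D x))) + \<gamma> * D (D (D (D (D x)))))" for x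
    unfolding DL by (simp add: derivation_mult derivation_simps \<gamma> algebra_simps)
  have DDDL: "D (D (D (L x))) = D (D (D \<alpha>)) * D x + D (D (D \<beta>)) * D (D x)
      + ((- D (D \<beta>)) * D (D (D x)) + \<alpha> * D (D (D (D x))) + \<beta> * D (D (D (D (D x))))
         + \<gamma> * D (D (D (D (D (D x))))))" for x
    unfolding L by (simp add: derivation_simps derivation_cubed_mult \<gamma> algebra_simps)

  have row1: "rows_det (D (L c), D (L d), D (L e)) (R 2) (R 3) = D \<alpha> * W 1 2 3 + \<gamma> * W 4 2 3"
    unfolding DL W_def R by (simp add: rows_det_def algebra_simps)
  have row2: "rows_det (R 1) (D (D (L c)), D (D (L d)), D (D (L e))) (R 3)
      = (D \<alpha> + D \<alpha> + D (D \<beta>)) * W 1 2 3 + (- \<beta>) * W 1 4 3 + \<gamma> * W 1 5 3"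
    unfolding DDL W_def R rows_det_comb_2 rows_det_lin_2 by simp
  have row3: "rows_det (R 1) (R 2) (D (D (D (L c))), D (D (D (L d))), D (D (D (L e))))
      = (- D (D \<beta>)) * W 1 2 3 + \<alpha> * W 1 2 4 + \<beta> * W 1 2 5 + \<gamma> * W 1 2 6"
    unfolding DDDL W_def R rows_det_comb_3 rows_det_lin_3 by simp
  have "V123 D (L c) d e + V123 D c (L d) e + V123 D c d (L e)
      = rows_det (D (L c), D (L d), D (L e)) (R 2) (R 3)
      + rows_det (R 1) (D (D (L c)), D (D (L d)), D (D (L e))) (R 3)
      + rows_det (R 1) (R 2) (D (D (D (L c))), D (D (D (L d))), D (D (D (L e))))"
    unfolding V123_eq_rows_det R by (rule rows_det_replace_columns)
  \<comment> \<open>The terms with \<open>D (D \<beta>)\<close> from \<open>row2\<close> and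
    \<open>row3\<close> cancel.\<close>
  also have "\<dots> = (D \<alpha> * W 1 2 3 + D \<alpha> * W 1 2 3 + D \<alpha> * W 1 2 3)
      + \<alpha> * W 1 2 4 + \<beta> * (W 1 2 5 - W 1 4 3) + \<gamma> * (W 4 2 3 + W 1 5 3 + W 1 2 6)"
    unfolding row1 row2 row3 by (simp add: algebra_simps)
  \<comment> \<open>After this sign change the factor of \<beta> is the right-hand side of
    \<open>D2\<close>.\<close>
  also have "W 1 4 3 = - W 1 3 4"
    unfolding W_def by (rule rows_det_swap_23)
  also have "(D \<alpha> * W 1 2 3 + D \<alpha> * W 1 2 3 + D \<alpha> * W 1 2 3)
      + \<alpha> * W 1 2 4 + \<beta> * (W 1 2 5 - (- W 1 3 4)) + \<gamma> * (W 4 2 3 + W 1 5 3 + W 1 2 6)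
      = L (W 1 2 3)"
    \<comment> \<open>Highest derivative first: rewriting with \<open>D1\<close> earlier would
      destroy the left-hand sides of \<open>D2\<close> and \<open>D3\<close>.\<close>
    unfolding L D3 unfolding D2 unfolding D1 triple_eq_0 by (simp add: algebra_simps)
  finally show ?thesis
    unfolding V by (rule sym)
qed

lemma V123_derivation_of_V123:
  "V123 D a b (V123 D c d e)
   = V123 D (V123 D a b c) d e + V123 D c (V123 D a b d) e + V123 D c d (V123 D a b e)"
proof (rule third_order_operator_derivation_of_V123)
  \<comment> \<open>Expansion along the third column: \<alpha>, \<beta>, \<gamma> are its
    cofactors.\<close>
  show "V123 D a b x = (D (D a) * D (D (D b)) - D (D (D a)) * D (D b)) * D x
      + (D (D (D a)) * D b - D a * D (D (D b))) * D (D x)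
      + (D a * D (D b) - D (D a) * D b) * D (D (D x))" for x
    by (simp add: V123_eq_rows_det rows_det_def algebra_simps)
  \<comment> \<open>The two products \<open>D (D a) * D (D b)\<close> cancel.\<close>
  show "D (D a * D (D b) - D (D a) * D b) = - (D (D (D a)) * D b - D a * D (D (D b)))"
    by (simp add: derivation_simps derivation_mult algebra_simps)
qed

text \<open>A cyclic shift of the columns is an even permutation, so the sum is three times one
  determinant.\<close>

lemma V123_cyclic: "V123 D a b c + V123 D b c a + V123 D c a b = 0"
proof -
  have "V123 D b c a = V123 D a b c" "V123 D c a b = V123 D a b c"
    by (simp_all add: V123_eq_rows_det rows_det_def algebra_simps)
  then show ?thesis
    by (simp add: triple_eq_0)
qed

lemma lie_triple_system_V123: "lie_triple_system scale (V123 D)"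
proof (intro lie_triple_system.intro lie_triple_system_axioms.intro)
  show "V123 D a a c = 0" for a c
    by (simp add: V123_eq_rows_det rows_det_def algebra_simps)
qed (rule vector_space_axioms V123_linear V123_cyclic V123_derivation_of_V123)+

end

end

theorem corollary1p3:
  fixes scale :: "'k::field \<Rightarrow> 'a::comm_ring \<Rightarrow> 'a"
    and D :: "'a \<Rightarrow> 'a"
  assumes "CHAR('k) = 3"
    and "comm_assoc_algebra_with_derivation scale D"
  shows "lie_triple_system scale (V123 D)"
  using assms(2,1) by (rule comm_assoc_algebra_with_derivation.lie_triple_system_V123)

end
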